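(* Let $n>1$ and $1\le k\le n$ be integers. If $k$ is a prime and $(n,k)=k$, then $\mathrm{Aut}(T_1)\cong \mathrm{Aut}(T_{11})\wr S_{k-1}$; for every $1\le h<h_0$, $\mathrm{Aut}(T_{1h})\cong\mathrm{Aut}(T_{1,h+1})\wr S_k$; and $\mathrm{Aut}(T_{1h_0})=\{1\}$.
   Context: Let $H$ be a cyclic group (written multiplicatively, identity $1$) with $n>1$ elements, let $1\le k\le n$, and let $f:H\to H$, $f(x)=x^k$. $G(n,k)$ is the digraph with vertex set $H$ and a directed edge from $a$ to $b$ if and only if $f(a)=b$ (loops allowed). $(n,k)$ is the greatest common divisor. $T_1$ is the tree attached to the identity element: its vertex set is $\{a\in H: a^{k^m}=1\text{ for some }m\ge 0\}$, and it is the induced subgraph of $G(n,k)$ on this set with the loop at $1$ deleted. The height of $a\in T_1$ is the smallest $m\ge 0$ with $a^{k^m}=1$, and $h_0$ is the largest height of a vertex of $T_1$; when $(n,k)=k$ is prime, $h_0\ge 1$. For $1\le h\le h_0$, $T_{1h}$ is the tree originating from a vertex $a$ of height $h$ in $T_1$, i.e. the induced subgraph on $\{x\in H: x^{k^j}=a\text{ for some } j\ge 0\}$; for $k$ prime its isomorphism type does not depend on the choice of $a$ (and $T_{1h_0}$ is a single point). $T_{11}$ means $T_{1h}$ with $h=1$. $\mathrm{Aut}(G)$ is the automorphism group of a digraph $G$, viewed as a permutation group on its vertices; $S_m$ is the symmetric group on $\{1,\ldots,m\}$. For permutation groups $P_1$ on $\{1,\ldots,m\}$ and $P_2$ on $\{1,\ldots,r\}$,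 the wreath product $P_1\wr P_2$ is the group generated by the direct product of $r$ copies of $P_1$ together with the elements of $P_2$ acting on (permuting) these $r$ copies. *)

theory Defs
  imports
    "HOL-Computational_Algebra.Primes"
    "Graph_Theory.Digraph_Isomorphism"
    "HOL-Algebra.Product_Groups"
    "HOL-Algebra.Sym_Groups"
    "HOL-Algebra.Multiplicative_Group"
begin

section \<open>Permutation groups and wreath products\<close>

text \<open>The library's \<^const>\<open>sym_group\<close> on an arbitrary set of points: bijections are represented,
  as there, by total functions that are the identity off the set.\<close>

definition perm_group :: "'a set \<Rightarrow> ('a \<Rightarrow> 'a) monoid"
  where "perm_group A = \<lparr>carrier = {p. p permutes A}, mult = (\<circ>), one = id\<rparr>"

lemma sym_group_eq_perm_group: "sym_group n = perm_group {1..n}"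
  by (simp add: sym_group_def perm_group_def)

lemma group_perm_group: "group (perm_group A)"
  using permutes_inv permutes_inv_o(2)
  by (auto intro!: groupI
      simp add: perm_group_def permutes_compose permutes_id comp_assoc, blast)

text \<open>\<open>P1\<close> is a permutation group on \<open>A\<close>, \<open>P2\<close> a permutation group on \<open>B\<close>.
  The wreath product acts on \<open>A \<times> B\<close>, the disjoint union of the copies \<open>A \<times> {b}\<close> of \<open>A\<close>.
  A family \<open>p\<close> in the direct product of copies of \<open>P1\<close> acts by \<open>p b\<close> on the copy \<open>A \<times> {b}\<close>,
  and \<open>q\<close> in \<open>P2\<close> moves the copy \<open>A \<times> {b}\<close> to the copy \<open>A \<times> {q b}\<close>.\<close>

definition wreath_base :: "'a set \<Rightarrow> 'b set \<Rightarrow> ('b \<Rightarrow> 'a \<Rightarrow> 'a) \<Rightarrow> 'a \<times> 'b \<Rightarrow> 'a \<times> 'b"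
  where "wreath_base A B p = (\<lambda>(a, b). if (a, b) \<in> A \<times> B then (p b a, b) else (a, b))"

definition wreath_top :: "'a set \<Rightarrow> 'b set \<Rightarrow> ('b \<Rightarrow> 'b) \<Rightarrow> 'a \<times> 'b \<Rightarrow> 'a \<times> 'b"
  where "wreath_top A B q = (\<lambda>(a, b). if (a, b) \<in> A \<times> B then (a, q b) else (a, b))"

definition wreath_product ::
  "('a \<Rightarrow> 'a) monoid \<Rightarrow> 'a set \<Rightarrow> ('b \<Rightarrow> 'b) monoid \<Rightarrow> 'b set \<Rightarrow> ('a \<times> 'b \<Rightarrow> 'a \<times> 'b) monoid"
  where "wreath_product P1 A P2 B =
    subgroup_generated (perm_group (A \<times> B))
      (wreath_base A B ` carrier (product_group B (\<lambda>_. P1)) \<union> wreath_top A B ` carrier P2)"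

text \<open>\<^const>\<open>subgroup_generated\<close> discards generators outside the ambient group; none are lost here.\<close>

lemma wreath_base_permutes:
  assumes "\<And>b. b \<in> B \<Longrightarrow> p b permutes A"
  shows "wreath_base A B p permutes A \<times> B"
proof (rule bij_imp_permutes)
  show "bij_betw (wreath_base A B p) (A \<times> B) (A \<times> B)"
  proof (rule bij_betw_byWitness[where f' = "wreath_base A B (\<lambda>b. inv' (p b))"])
    show "\<forall>x\<in>A \<times> B. wreath_base A B (\<lambda>b. inv' (p b)) (wreath_base A B p x) = x"
      using assms
      by (auto simp: wreath_base_def permutes_in_image permutes_inverses(2)[of _ A])
    show "\<forall>x\<in>A \<times> B. wreath_base A B p (wreath_base A B (\<lambda>b. inv' (p b)) x) = x"
      using assms
      by (auto simp: wreath_base_def permutes_in_image[OF permutes_inv] permutes_inverses(1)[of _ A])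
    show "wreath_base A B p ` (A \<times> B) \<subseteq> A \<times> B"
      using assms by (auto simp: wreath_base_def permutes_in_image)
    show "wreath_base A B (\<lambda>b. inv' (p b)) ` (A \<times> B) \<subseteq> A \<times> B"
      using assms by (auto simp: wreath_base_def permutes_in_image[OF permutes_inv])
  qed
qed (auto simp: wreath_base_def split: if_splits)

lemma wreath_top_permutes:
  assumes "q permutes B"
  shows "wreath_top A B q permutes A \<times> B"
proof (rule bij_imp_permutes)
  show "bij_betw (wreath_top A B q) (A \<times> B) (A \<times> B)"
  proof (rule bij_betw_byWitness[where f' = "wreath_top A B (inv' q)"])
    show "\<forall>x\<in>A \<times> B. wreath_top A B (inv' q) (wreath_top A B q x) = x"
      using assms by (auto simp: wreath_top_def permutes_in_image permutes_inverses)
    show "\<forall>x\<in>A \<times> B. wreath_top A B q (wreath_top A B (inv' q) x) = x"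
      using assms
      by (auto simp: wreath_top_def permutes_in_image[OF permutes_inv] permutes_inverses)
    show "wreath_top A B q ` (A \<times> B) \<subseteq> A \<times> B"
      using assms by (auto simp: wreath_top_def permutes_in_image)
    show "wreath_top A B (inv' q) ` (A \<times> B) \<subseteq> A \<times> B"
      using assms by (auto simp: wreath_top_def permutes_in_image[OF permutes_inv])
  qed
qed (auto simp: wreath_top_def split: if_splits)

lemma wreath_generators_subset:
  assumes "carrier P1 \<subseteq> {p. p permutes A}" "carrier P2 \<subseteq> {q. q permutes B}"
  shows "wreath_base A B ` carrier (product_group B (\<lambda>_. P1)) \<union> wreath_top A B ` carrier P2
    \<subseteq> carrier (perm_group (A \<times> B))"
  using assms by (fastforce simp: perm_group_def intro!: wreath_base_permutes wreath_top_permutes)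

section \<open>Automorphism groups of digraphs\<close>

text \<open>A digraph isomorphism of the library also carries a map on arcs, so an automorphism is
  a \<open>hom\<close> with \<open>app_iso hom G = G\<close>; we keep the permutation that it induces on the vertices.\<close>

definition digraph_aut :: "('a, 'b) pre_digraph \<Rightarrow> ('a \<Rightarrow> 'a) monoid"
  where "digraph_aut G = (perm_group (verts G))\<lparr>carrier :=
    {p. p permutes verts G \<and>
        (\<exists>hom. pre_digraph.digraph_isomorphism G hom \<and> app_iso hom G = G \<and>
               (\<forall>v\<in>verts G. iso_verts hom v = p v))}\<rparr>"

section \<open>The digraph of a power map\<close>

definition power_digraph :: "('a, 'm) monoid_scheme \<Rightarrow> nat \<Rightarrow> ('a, 'a \<times> 'a) pre_digraph"
  where "power_digraph H k =
    \<lparr>verts = carrier H,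
     arcs = {(a, b). a \<in> carrier H \<and> b \<in> carrier H \<and> a [^]\<^bsub>H\<^esub> k = b},
     tail = fst, head = snd\<rparr>"

definition tree_one_verts :: "('a, 'm) monoid_scheme \<Rightarrow> nat \<Rightarrow> 'a set"
  where "tree_one_verts H k = {a \<in> carrier H. \<exists>m. a [^]\<^bsub>H\<^esub> (k ^ m) = \<one>\<^bsub>H\<^esub>}"

definition tree_one :: "('a, 'm) monoid_scheme \<Rightarrow> nat \<Rightarrow> ('a, 'a \<times> 'a) pre_digraph"
  where "tree_one H k =
    pre_digraph.del_arc (power_digraph H k \<restriction> tree_one_verts H k) (\<one>\<^bsub>H\<^esub>, \<one>\<^bsub>H\<^esub>)"

definition height :: "('a, 'm) monoid_scheme \<Rightarrow> nat \<Rightarrow> 'a \<Rightarrow> nat"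
  where "height H k a = (LEAST m. a [^]\<^bsub>H\<^esub> (k ^ m) = \<one>\<^bsub>H\<^esub>)"

definition max_height :: "('a, 'm) monoid_scheme \<Rightarrow> nat \<Rightarrow> nat"
  where "max_height H k = Max (height H k ` tree_one_verts H k)"

text \<open>The tree originating from \<open>a\<close>. Its isomorphism type depends only on the height \<open>h\<close> of \<open>a\<close>
  (for prime \<open>k\<close> and \<open>h \<ge> 1\<close>), so it is indexed by the vertex instead of by \<open>h\<close>.\<close>

definition tree_from :: "('a, 'm) monoid_scheme \<Rightarrow> nat \<Rightarrow> 'a \<Rightarrow> ('a, 'a \<times> 'a) pre_digraph"
  where "tree_from H k a =
    power_digraph H k \<restriction> {x \<in> carrier H. \<exists>j. x [^]\<^bsub>H\<^esub> (k ^ j) = a}"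

lemma nomulti_digraph_trees:
  "nomulti_digraph (power_digraph H k)"
  "group H \<Longrightarrow> nomulti_digraph (tree_one H k)"
  "nomulti_digraph (tree_from H k a)"
  by unfold_locales
    (auto simp: power_digraph_def tree_one_def tree_from_def pre_digraph.del_arc_def
      induce_subgraph_def arc_to_ends_def)

text \<open>These digraphs have no parallel arcs, so their automorphisms are the vertex permutations
  that preserve and reflect adjacency.\<close>

lemma digraph_aut_iff:
  assumes "nomulti_digraph G"
  shows "p \<in> carrier (digraph_aut G) \<longleftrightarrow>
    p permutes verts G \<and> (\<forall>u\<in>verts G. \<forall>v\<in>verts G. u \<rightarrow>\<^bsub>G\<^esub> v \<longleftrightarrow> p u \<rightarrow>\<^bsub>G\<^esub> p v)"
proof -
  interpret nomulti_digraph G by fact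
  show ?thesis
  proof
    assume "p \<in> carrier (digraph_aut G)"
    then obtain hom where p: "p permutes verts G" and iso: "digraph_isomorphism hom"
      and app: "app_iso hom G = G" and hom_p: "\<And>v. v \<in> verts G \<Longrightarrow> iso_verts hom v = p v"
      by (auto simp: digraph_aut_def)
    have arcs: "iso_arcs hom ` arcs G = arcs G"
      and ends: "iso_tail hom = tail G" "iso_head hom = head G"
      using arg_cong[OF app, of arcs] arg_cong[OF app, of tail] arg_cong[OF app, of head]
      by simp_all
    have tail_p: "tail G (iso_arcs hom e) = p (tail G e)"
      and head_p: "head G (iso_arcs hom e) = p (head G e)" if "e \<in> arcs G" for e
      using that iso hom_p ends by (auto simp: digraph_isomorphism_def)
    have fwd: "p u \<rightarrow>\<^bsub>G\<^esub> p v" if "u \<rightarrow>\<^bsub>G\<^esub> v" for u v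
    proof -
      from that obtain e where e: "e \<in> arcs G" "tail G e = u" "head G e = v"
        by (auto simp: arcs_ends_conv)
      then have "iso_arcs hom e \<in> arcs G" using arcs by blast
      with e show ?thesis using tail_p head_p by (force simp: arcs_ends_conv)
    qed
    have bwd: "u \<rightarrow>\<^bsub>G\<^esub> v" if "p u \<rightarrow>\<^bsub>G\<^esub> p v" for u v
    proof -
      from that obtain e' where e': "e' \<in> arcs G" "tail G e' = p u" "head G e' = p v"
        by (auto simp: arcs_ends_conv)
      then obtain e where e: "e \<in> arcs G" "e' = iso_arcs hom e" using arcs by blast
      have "tail G e = u" "head G e = v"
        using e e' tail_p head_p permutes_inj[OF p] by (auto dest: injD)
      with e show ?thesis by (force simp: arcs_ends_conv)
    qed
    show "p permutes verts G \<and> (\<forall>u\<in>verts G. \<forall>v\<in>verts G. u \<rightarrow>\<^bsub>G\<^esub> v \<longleftrightarrow> p u \<rightarrow>\<^bsub>G\<^esub> p v)"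
      using p fwd bwd by blast
  next
    assume "p permutes verts G \<and> (\<forall>u\<in>verts G. \<forall>v\<in>verts G. u \<rightarrow>\<^bsub>G\<^esub> v \<longleftrightarrow> p u \<rightarrow>\<^bsub>G\<^esub> p v)"
    then have p: "p permutes verts G"
      and adj: "\<And>u v. u \<in> verts G \<Longrightarrow> v \<in> verts G \<Longrightarrow> u \<rightarrow>\<^bsub>G\<^esub> v \<longleftrightarrow> p u \<rightarrow>\<^bsub>G\<^esub> p v"
      by blast+
    define f where "f e = inv_into (arcs G) (arc_to_ends G) (p (tail G e), p (head G e))" for e
    have f: "f e \<in> arcs G" "tail G (f e) = p (tail G e)" "head G (f e) = p (head G e)"
      if "e \<in> arcs G" for e
    proof -
      have "tail G e \<rightarrow>\<^bsub>G\<^esub> head G e" using that by (auto simp: arcs_ends_conv)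
      then have *: "(p (tail G e), p (head G e)) \<in> arc_to_ends G ` arcs G"
        using adj that by (simp add: arcs_ends_def)
      show "f e \<in> arcs G" unfolding f_def by (rule inv_into_into[OF *])
      show "tail G (f e) = p (tail G e)" "head G (f e) = p (head G e)"
        using f_inv_into_f[OF *] by (simp_all add: f_def arc_to_ends_def)
    qed
    have "inj_on f (arcs G)"
    proof (rule inj_onI)
      fix d e assume d: "d \<in> arcs G" and e: "e \<in> arcs G" and "f d = f e"
      then have "p (tail G d) = p (tail G e)" "p (head G d) = p (head G e)"
        using f by metis+
      then have "arc_to_ends G d = arc_to_ends G e"
        using permutes_inj[OF p] by (auto simp: arc_to_ends_def dest: injD)
      with d e show "d = e" by (rule no_multi_arcs)
    qed
    moreover have "f ` arcs G = arcs G"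
    proof
      show "f ` arcs G \<subseteq> arcs G" using f by blast
      show "arcs G \<subseteq> f ` arcs G"
      proof
        fix e assume e: "e \<in> arcs G"
        let ?u = "inv' p (tail G e)" and ?v = "inv' p (head G e)"
        have uv: "?u \<in> verts G" "?v \<in> verts G" "p ?u = tail G e" "p ?v = head G e"
          using e permutes_inverses[OF p] permutes_in_image[OF permutes_inv[OF p]] by simp_all
        have "tail G e \<rightarrow>\<^bsub>G\<^esub> head G e" using e by (auto simp: arcs_ends_conv)
        then have "?u \<rightarrow>\<^bsub>G\<^esub> ?v" using adj uv by simp
        then obtain d where d: "d \<in> arcs G" "tail G d = ?u" "head G d = ?v"
          by (auto simp: arcs_ends_conv)
        then have "arc_to_ends G (f d) = arc_to_ends G e"
          using f[of d] uv by (simp add: arc_to_ends_def)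
        then have "f d = e" using no_multi_arcs[of "f d" e] f[of d] d e by blast
        then show "e \<in> f ` arcs G" using d by blast
      qed
    qed
    moreover have "inj_on p (verts G)" "p ` verts G = verts G"
      using p permutes_inj_on permutes_image by blast+
    ultimately have "digraph_isomorphism \<lparr>iso_verts = p, iso_arcs = f, iso_head = head G, iso_tail = tail G\<rparr>"
        "app_iso \<lparr>iso_verts = p, iso_arcs = f, iso_head = head G, iso_tail = tail G\<rparr> G = G"
      using f wf_digraph by (auto simp: digraph_isomorphism_def app_iso_def)
    with p show "p \<in> carrier (digraph_aut G)"
      unfolding digraph_aut_def by force
  qed
qed

text \<open>Vertices of every height up to \<^const>\<open>max_height\<close> exist, and \<^const>\<open>max_height\<close> is
  positive when the prime \<open>k\<close> divides the order of the cyclic group, so that quantifying over the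
  vertices of a given height is never vacuous.\<close>

lemma ex_height:
  assumes "group H" "finite (carrier H)" "h \<le> max_height H k"
  shows "\<exists>a\<in>tree_one_verts H k. height H k a = h"
proof -
  interpret group H by fact
  have fin: "finite (tree_one_verts H k)"
    using assms(2) by (simp add: tree_one_verts_def)
  have "\<one>\<^bsub>H\<^esub> \<in> tree_one_verts H k" by (simp add: tree_one_verts_def)
  then have "max_height H k \<in> height H k ` tree_one_verts H k"
    unfolding max_height_def using fin by (intro Max_in) auto
  then obtain c where c: "c \<in> tree_one_verts H k" "height H k c = max_height H k" by auto
  then obtain m where cH: "c \<in> carrier H" and m: "c [^]\<^bsub>H\<^esub> (k ^ m) = \<one>\<^bsub>H\<^esub>"
    by (auto simp: tree_one_verts_def)
  define M where "M = max_height H k"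
  have M: "c [^]\<^bsub>H\<^esub> (k ^ M) = \<one>\<^bsub>H\<^esub>"
    unfolding M_def c(2)[symmetric] height_def
    using m by (rule LeastI[where P = "\<lambda>m. c [^]\<^bsub>H\<^esub> (k ^ m) = \<one>\<^bsub>H\<^esub>"])
  have M_least: "M \<le> m'" if "c [^]\<^bsub>H\<^esub> (k ^ m') = \<one>\<^bsub>H\<^esub>" for m'
    unfolding M_def c(2)[symmetric] height_def
    using that by (rule Least_le[where P = "\<lambda>m. c [^]\<^bsub>H\<^esub> (k ^ m) = \<one>\<^bsub>H\<^esub>"])
  define a where "a = c [^]\<^bsub>H\<^esub> (k ^ (M - h))"
  have h: "h \<le> M" using assms(3) by (simp add: M_def)
  have a_pow: "a [^]\<^bsub>H\<^esub> (k ^ i) = c [^]\<^bsub>H\<^esub> (k ^ (M - h + i))" for i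
    using cH by (simp add: a_def nat_pow_pow power_add)
  have a1: "a [^]\<^bsub>H\<^esub> (k ^ h) = \<one>\<^bsub>H\<^esub>" using a_pow[of h] h M by simp
  have "a \<in> tree_one_verts H k"
    using a1 cH by (auto simp: tree_one_verts_def a_def)
  moreover have "height H k a = h"
    unfolding height_def
  proof (rule Least_equality)
    show "a [^]\<^bsub>H\<^esub> (k ^ h) = \<one>\<^bsub>H\<^esub>" by (rule a1)
    show "h \<le> i" if "a [^]\<^bsub>H\<^esub> (k ^ i) = \<one>\<^bsub>H\<^esub>" for i
      using M_least[of "M - h + i"] that a_pow[of i] h by simp
  qed
  ultimately show ?thesis by blast
qed

lemma max_height_pos:
  assumes "group H" "cyclic_group H" "order H = n" "n > 1" "prime k" "gcd n k = k"
  shows "max_height H k \<ge> 1"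
proof -
  interpret group H by fact
  have finH: "finite (carrier H)"
    using assms(3,4) by (auto simp: order_def intro: card_ge_0_finite)
  have kn: "k dvd n" using assms(6) by (metis gcd_dvd1)
  have k1: "k > 1" using \<open>prime k\<close> by (rule prime_gt_1_nat)
  obtain g where g: "g \<in> carrier H" "subgroup_generated H {g} = H"
    using assms(2) by (auto simp: cyclic_group_def)
  have "ord g = n"
    using cyclic_order_is_ord[OF g(1)] g(2) assms(3) by simp
  define c where "c = g [^]\<^bsub>H\<^esub> (n div k)"
  have cH: "c \<in> carrier H" using g by (simp add: c_def)
  have "c [^]\<^bsub>H\<^esub> k = \<one>\<^bsub>H\<^esub>"
    using g kn pow_ord_eq_1[OF g(1)] \<open>ord g = n\<close> by (simp add: c_def nat_pow_pow)
  then have c1: "c [^]\<^bsub>H\<^esub> (k ^ 1) = \<one>\<^bsub>H\<^esub>" by simp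
  have "0 < n div k" "n div k < n"
    using kn k1 assms(4) by (auto simp: dvd_imp_le div_greater_zero_iff)
  then have "c \<noteq> \<one>\<^bsub>H\<^esub>"
    using pow_eq_id[OF g(1)] \<open>ord g = n\<close> by (auto simp: c_def dest: dvd_imp_le)
  have "c [^]\<^bsub>H\<^esub> (k ^ height H k c) = \<one>\<^bsub>H\<^esub>"
    unfolding height_def
    using c1 by (rule LeastI[where P = "\<lambda>m. c [^]\<^bsub>H\<^esub> (k ^ m) = \<one>\<^bsub>H\<^esub>"])
  then have "height H k c \<noteq> 0" using \<open>c \<noteq> \<one>\<^bsub>H\<^esub>\<close> cH by (cases "height H k c") auto
  moreover have "c \<in> tree_one_verts H k" using cH c1 unfolding tree_one_verts_def by blast
  then have "height H k c \<le> max_height H k"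
    unfolding max_height_def using finH by (intro Max_ge) (auto simp: tree_one_verts_def)
  ultimately show ?thesis by linarith
qed

end

theory Submission
  imports Defs "HOL-Number_Theory.Cong"
begin

text \<open>A rooted tree whose root carries \<open>m\<close> branches, all isomorphic to one rooted tree \<open>T\<close>, has
  automorphism group \<open>Aut T \<wr> S\<^sub>m\<close>: an automorphism fixes the root, hence permutes the roots of the
  branches, hence the branches, and after this permutation is undone only an automorphism on each
  branch is left. This is \<open>branch_copies.digraph_aut_iso_wreath_product\<close>. There a rooted
  tree is a digraph with a sink that every vertex reaches (\<open>sink_digraph\<close>). The proof rests on the
  description of the wreath product as the group of all permutations of the disjoint union of the
  copies of \<open>T\<close> that respect arcs and roots (\<open>carrier_wreath_product_aut\<close>).

  In the digraph of \<open>x \<mapsto> x\<^sup>k\<close> the branches at a vertex \<open>a\<close> of \<open>T\<^sub>1\<close> are the trees originating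
  from the preimages of \<open>a\<close> other than \<open>a\<close>. These preimages have height one more than \<open>a\<close>, and
  their trees are isomorphic by a power map: an element of height \<open>h\<close> has order \<open>k\<^sup>h\<close>, so two elements
  \<open>b\<close>, \<open>c\<close> of the same positive height generate the same subgroup of the cyclic group, and
  \<open>c = b\<^sup>u\<close> with \<open>u\<close> prime to \<open>k\<close> (\<open>same_height_imp_coprime_pow\<close>). The map \<open>x \<mapsto> x\<^sup>u\<close> commutes
  with \<open>x \<mapsto> x\<^sup>k\<close> and is invertible on \<open>T\<^sub>1\<close>, so it carries the tree of \<open>b\<close> onto that of \<open>c\<close>.

  What remains is to count the branches. A preimage set is a coset of the kernel, which has \<open>k\<close>
  elements since \<open>k\<close> divides the order of the group. At the identity one of them is the identity
  itself, which leaves \<open>k - 1\<close> branches; at a vertex of height \<open>h\<close> with \<open>1 \<le> h < h\<^sub>0\<close> all \<open>k\<close>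
  count, and a preimage exists because some vertex of height \<open>h\<close> has one and power maps move
  it to every other. Above a vertex of height \<open>h\<^sub>0\<close> there is nothing.\<close>

section \<open>Composition and inverses of automorphisms\<close>

lemma inv_perm_group:
  assumes "p permutes A"
  shows "inv\<^bsub>perm_group A\<^esub> p = inv' p"
  using assms permutes_inv[OF assms]
  by (intro group.inv_equality[OF group_perm_group])
     (auto simp: perm_group_def permutes_inv_o)

lemma (in nomulti_digraph) aut_comp:
  assumes p: "p \<in> carrier (digraph_aut G)" and q: "q \<in> carrier (digraph_aut G)"
  shows "p \<circ> q \<in> carrier (digraph_aut G)"
proof -
  note aut = digraph_aut_iff[OF nomulti_digraph_axioms]
  have perm: "p permutes verts G" "q permutes verts G"
    using p q unfolding aut by blast+
  have "u \<rightarrow>\<^bsub>G\<^esub> v \<longleftrightarrow> p (q u) \<rightarrow>\<^bsub>G\<^esub> p (q v)" if "u \<in> verts G" "v \<in> verts G" for u v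
    using p q that permutes_in_image[OF perm(2)] unfolding aut by blast
  then show ?thesis
    unfolding aut using permutes_compose[OF perm(2,1)] by simp
qed

section \<open>Rooted digraphs\<close>

text \<open>The features of a rooted tree, with arcs directed to the root, that determine how
  automorphisms treat the root.\<close>

locale sink_digraph = nomulti_digraph T for T :: "('a, 'e) pre_digraph" +
  fixes t :: 'a
  assumes sink_in_verts: "t \<in> verts T"
    and sink_no_out: "\<not> t \<rightarrow>\<^bsub>T\<^esub> x"
    and reaches_sink: "x \<in> verts T \<Longrightarrow> (x, t) \<in> (arcs_ends T)\<^sup>*"
begin

lemma sink_iff_no_out:
  assumes "x \<in> verts T"
  shows "x = t \<longleftrightarrow> (\<forall>y\<in>verts T. \<not> x \<rightarrow>\<^bsub>T\<^esub> y)"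
proof (cases "x = t")
  case False
  with reaches_sink[OF assms] obtain y where "x \<rightarrow>\<^bsub>T\<^esub> y"
    by (auto elim: converse_rtranclE)
  moreover from this have "y \<in> verts T"
    by (rule adj_in_verts)
  ultimately show ?thesis
    using False by blast
qed (simp add: sink_no_out)

text \<open>The root is the only vertex without an outgoing arc, a property that automorphisms preserve.\<close>

lemma aut_fixes_sink:
  assumes p: "p \<in> carrier (digraph_aut T)" and x: "x \<in> verts T"
  shows "p x = t \<longleftrightarrow> x = t"
proof -
  have perm: "p permutes verts T"
    and adj: "\<And>u v. u \<in> verts T \<Longrightarrow> v \<in> verts T \<Longrightarrow> u \<rightarrow>\<^bsub>T\<^esub> v \<longleftrightarrow> p u \<rightarrow>\<^bsub>T\<^esub> p v"
    using p by (auto simp: digraph_aut_iff[OF nomulti_digraph_axioms])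
  have px: "p x \<in> verts T"
    using x by (simp add: permutes_in_image[OF perm])
  have "(\<forall>y\<in>verts T. \<not> p x \<rightarrow>\<^bsub>T\<^esub> y) \<longleftrightarrow> (\<forall>y\<in>p ` verts T. \<not> p x \<rightarrow>\<^bsub>T\<^esub> y)"
    by (simp only: permutes_image[OF perm])
  also have "\<dots> \<longleftrightarrow> (\<forall>y\<in>verts T. \<not> x \<rightarrow>\<^bsub>T\<^esub> y)"
    using adj x by auto
  finally show ?thesis
    using sink_iff_no_out[OF px] sink_iff_no_out[OF x] by simp
qed

section \<open>The wreath product as the automorphisms of copies of a tree\<close>

text \<open>The automorphisms of the disjoint union of copies of \<open>T\<close>, one for each \<open>b \<in> B\<close>, on the
  vertex set \<open>verts T \<times> B\<close>. They have to send roots to roots, because the roots are where the copies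
  get attached to a common vertex.\<close>

definition forest_auts :: "'b set \<Rightarrow> ('a \<times> 'b \<Rightarrow> 'a \<times> 'b) set" where
  "forest_auts B = {\<sigma>. \<sigma> permutes verts T \<times> B \<and>
     (\<forall>z\<in>verts T \<times> B. \<forall>w\<in>verts T \<times> B.
        (snd z = snd w \<and> fst z \<rightarrow>\<^bsub>T\<^esub> fst w) \<longleftrightarrow>
        (snd (\<sigma> z) = snd (\<sigma> w) \<and> fst (\<sigma> z) \<rightarrow>\<^bsub>T\<^esub> fst (\<sigma> w))) \<and>
     (\<forall>z\<in>verts T \<times> B. fst (\<sigma> z) = t \<longleftrightarrow> fst z = t)}"

lemma forest_autsD:
  assumes "\<sigma> \<in> forest_auts B"
  shows "\<sigma> permutes verts T \<times> B"
    and "z \<in> verts T \<times> B \<Longrightarrow> w \<in> verts T \<times> B \<Longrightarrow>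
      (snd z = snd w \<and> fst z \<rightarrow>\<^bsub>T\<^esub> fst w) \<longleftrightarrow>
      (snd (\<sigma> z) = snd (\<sigma> w) \<and> fst (\<sigma> z) \<rightarrow>\<^bsub>T\<^esub> fst (\<sigma> w))"
    and "z \<in> verts T \<times> B \<Longrightarrow> fst (\<sigma> z) = t \<longleftrightarrow> fst z = t"
  using assms unfolding forest_auts_def by blast+

lemma subgroup_forest_auts: "subgroup (forest_auts B) (perm_group (verts T \<times> B))"
proof (rule group.subgroupI[OF group_perm_group])
  show "forest_auts B \<subseteq> carrier (perm_group (verts T \<times> B))"
    by (auto simp: forest_auts_def perm_group_def)
  have "id \<in> forest_auts B"
    by (simp add: forest_auts_def permutes_id)
  then show "forest_auts B \<noteq> {}"
    by blast
next
  fix \<sigma> assume \<sigma>: "\<sigma> \<in> forest_auts B"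
  note p = forest_autsD(1)[OF \<sigma>]
  let ?\<tau> = "inv' \<sigma>"
  have in_im: "?\<tau> z \<in> verts T \<times> B" if "z \<in> verts T \<times> B" for z
    using that permutes_in_image[OF permutes_inv[OF p]] by blast
  have canc: "\<sigma> (?\<tau> z) = z" for z
    by (rule permutes_inverses(1)[OF p])
  have "?\<tau> \<in> forest_auts B"
    unfolding forest_auts_def
  proof (intro CollectI conjI ballI)
    show "?\<tau> permutes verts T \<times> B"
      by (rule permutes_inv[OF p])
    show "(snd z = snd w \<and> fst z \<rightarrow>\<^bsub>T\<^esub> fst w) \<longleftrightarrow>
        (snd (?\<tau> z) = snd (?\<tau> w) \<and> fst (?\<tau> z) \<rightarrow>\<^bsub>T\<^esub> fst (?\<tau> w))"
      if "z \<in> verts T \<times> B" "w \<in> verts T \<times> B" for z w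
      using forest_autsD(2)[OF \<sigma> in_im[OF that(1)] in_im[OF that(2)]] by (simp only: canc)
    show "fst (?\<tau> z) = t \<longleftrightarrow> fst z = t" if "z \<in> verts T \<times> B" for z
      using forest_autsD(3)[OF \<sigma> in_im[OF that]] by (simp only: canc)
  qed
  then show "inv\<^bsub>perm_group (verts T \<times> B)\<^esub> \<sigma> \<in> forest_auts B"
    by (simp only: inv_perm_group[OF p])
next
  fix \<sigma> \<tau> assume \<sigma>: "\<sigma> \<in> forest_auts B" and \<tau>: "\<tau> \<in> forest_auts B"
  have in_im: "\<tau> z \<in> verts T \<times> B" if "z \<in> verts T \<times> B" for z
    using that permutes_in_image[OF forest_autsD(1)[OF \<tau>]] by blast
  have "\<sigma> \<circ> \<tau> \<in> forest_auts B"
    unfolding forest_auts_def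
  proof (intro CollectI conjI ballI)
    show "\<sigma> \<circ> \<tau> permutes verts T \<times> B"
      using forest_autsD(1)[OF \<tau>] forest_autsD(1)[OF \<sigma>] by (rule permutes_compose)
    show "(snd z = snd w \<and> fst z \<rightarrow>\<^bsub>T\<^esub> fst w) \<longleftrightarrow>
        (snd ((\<sigma> \<circ> \<tau>) z) = snd ((\<sigma> \<circ> \<tau>) w) \<and> fst ((\<sigma> \<circ> \<tau>) z) \<rightarrow>\<^bsub>T\<^esub> fst ((\<sigma> \<circ> \<tau>) w))"
      if "z \<in> verts T \<times> B" "w \<in> verts T \<times> B" for z w
      using forest_autsD(2)[OF \<tau> that] forest_autsD(2)[OF \<sigma> in_im[OF that(1)] in_im[OF that(2)]]
      by (simp only: o_apply)
    show "fst ((\<sigma> \<circ> \<tau>) z) = t \<longleftrightarrow> fst z = t" if "z \<in> verts T \<times> B" for z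
      using forest_autsD(3)[OF \<tau> that] forest_autsD(3)[OF \<sigma> in_im[OF that]]
      by (simp only: o_apply)
  qed
  then show "\<sigma> \<otimes>\<^bsub>perm_group (verts T \<times> B)\<^esub> \<tau> \<in> forest_auts B"
    by (simp add: perm_group_def)
qed

lemma wreath_base_in_forest_auts:
  assumes "p \<in> carrier (product_group B (\<lambda>_. digraph_aut T))"
  shows "wreath_base (verts T) B p \<in> forest_auts B"
proof -
  have p: "p b \<in> carrier (digraph_aut T)" if "b \<in> B" for b
    using assms that by (auto simp: PiE_def)
  then have perm: "p b permutes verts T"
    and adj: "u \<in> verts T \<Longrightarrow> v \<in> verts T \<Longrightarrow> u \<rightarrow>\<^bsub>T\<^esub> v \<longleftrightarrow> p b u \<rightarrow>\<^bsub>T\<^esub> p b v"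
    if "b \<in> B" for b u v
    using that by (auto simp: digraph_aut_iff[OF nomulti_digraph_axioms])
  have "wreath_base (verts T) B p permutes verts T \<times> B"
    by (rule wreath_base_permutes) (rule perm)
  then show ?thesis
    unfolding forest_auts_def using aut_fixes_sink[OF p] adj
    by (auto simp: wreath_base_def)
qed

lemma wreath_top_in_forest_auts:
  assumes q: "q permutes B"
  shows "wreath_top (verts T) B q \<in> forest_auts B"
  using wreath_top_permutes[OF q, of "verts T"] permutes_inj[OF q]
  by (auto simp: forest_auts_def wreath_top_def inj_eq)

text \<open>The root of a copy goes to the root of a copy, which defines \<open>q\<close>; every other vertex
  follows its root because arcs, and hence paths to the root, stay within one copy.\<close>

lemma forest_aut_permutes_copies:
  assumes \<sigma>: "\<sigma> \<in> forest_auts B"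
  obtains q where "q permutes B"
    and "\<And>a b. a \<in> verts T \<Longrightarrow> b \<in> B \<Longrightarrow> snd (\<sigma> (a, b)) = q b"
proof -
  note p = forest_autsD(1)[OF \<sigma>] and root = forest_autsD(3)[OF \<sigma>]
  define q where "q b = (if b \<in> B then snd (\<sigma> (t, b)) else b)" for b
  have snd_q: "snd (\<sigma> (a, b)) = q b" if "a \<in> verts T" "b \<in> B" for a b
    using reaches_sink[OF that(1)]
  proof (induction rule: converse_rtrancl_induct)
    case base
    show ?case
      using that by (simp add: q_def)
  next
    case (step y z)
    then have "(y, b) \<in> verts T \<times> B" "(z, b) \<in> verts T \<times> B"
      using that adj_in_verts by auto
    then show ?case
      using forest_autsD(2)[OF \<sigma>] step by fastforce
  qed
  have on_root: "\<sigma> (t, b) = (t, q b)" "q b \<in> B" if "b \<in> B" for b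
    using that root[of "(t, b)"] sink_in_verts permutes_in_image[OF p, of "(t, b)"]
    by (auto simp: q_def mem_Times_iff prod_eq_iff)
  have "bij_betw q B B"
  proof (rule bij_betw_imageI)
    show "inj_on q B"
    proof (rule inj_onI)
      fix b c assume "b \<in> B" "c \<in> B" "q b = q c"
      then have "\<sigma> (t, b) = \<sigma> (t, c)"
        by (simp add: on_root)
      then show "b = c"
        using permutes_inj[OF p] by (auto dest: injD)
    qed
    show "q ` B = B"
    proof
      show "q ` B \<subseteq> B"
        using on_root by blast
      show "B \<subseteq> q ` B"
      proof
        fix c assume c: "c \<in> B"
        then have "(t, c) \<in> \<sigma> ` (verts T \<times> B)"
          using sink_in_verts by (simp add: permutes_image[OF p])
        then obtain a b where ab: "a \<in> verts T" "b \<in> B" "\<sigma> (a, b) = (t, c)"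
          by auto
        then show "c \<in> q ` B"
          using snd_q[of a b] by force
      qed
    qed
  qed
  then have "q permutes B"
    by (rule bij_imp_permutes) (simp add: q_def)
  then show ?thesis
    using snd_q by (rule that)
qed

text \<open>Undoing the permutation \<open>q\<close> of the copies leaves a map that preserves each copy. The
  component on copy \<open>c\<close> is read off on the copy \<open>q\<inverse> c\<close> that is moved there, because the top
  group acts first.\<close>

lemma forest_aut_decomp:
  assumes \<sigma>: "\<sigma> \<in> forest_auts B"
  obtains p q where "p \<in> carrier (product_group B (\<lambda>_. digraph_aut T))" "q permutes B"
    "\<sigma> = wreath_base (verts T) B p \<circ> wreath_top (verts T) B q"
proof -
  note perm = forest_autsD(1)[OF \<sigma>]
  obtain q where q: "q permutes B"
    and snd_q: "\<And>a b. a \<in> verts T \<Longrightarrow> b \<in> B \<Longrightarrow> snd (\<sigma> (a, b)) = q b"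
    using forest_aut_permutes_copies[OF \<sigma>] by blast
  \<comment> \<open>restricted to \<open>B\<close>, since the product group consists of extensional families\<close>
  define p where "p = (\<lambda>c\<in>B. \<lambda>a. if a \<in> verts T then fst (\<sigma> (a, inv' q c)) else a)"
  have q_inv: "inv' q c \<in> B" "q (inv' q c) = c" if "c \<in> B" for c
    using that q by (simp_all add: permutes_in_image[OF permutes_inv] permutes_inverses)
  have val: "\<sigma> (a, inv' q c) = (p c a, c)" "p c a \<in> verts T" if "a \<in> verts T" "c \<in> B" for a c
  proof -
    show "\<sigma> (a, inv' q c) = (p c a, c)"
      using that q_inv snd_q by (simp add: p_def prod_eq_iff)
    moreover have "\<sigma> (a, inv' q c) \<in> verts T \<times> B"
      using that q_inv by (simp add: permutes_in_image[OF perm])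
    ultimately show "p c a \<in> verts T"
      by simp
  qed
  have "p c \<in> carrier (digraph_aut T)" if c: "c \<in> B" for c
    unfolding digraph_aut_iff[OF nomulti_digraph_axioms]
  proof (intro conjI ballI)
    have "bij_betw (p c) (verts T) (verts T)"
    proof (rule bij_betw_imageI)
      show "inj_on (p c) (verts T)"
      proof (rule inj_onI)
        fix a a' assume "a \<in> verts T" "a' \<in> verts T" "p c a = p c a'"
        then have "\<sigma> (a, inv' q c) = \<sigma> (a', inv' q c)"
          using c by (simp add: val)
        then show "a = a'"
          using permutes_inj[OF perm] by (auto dest: injD)
      qed
      show "p c ` verts T = verts T"
      proof
        show "p c ` verts T \<subseteq> verts T"
          using val c by blast
        show "verts T \<subseteq> p c ` verts T"
        proof
          fix a' assume "a' \<in> verts T"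
          then have "(a', c) \<in> \<sigma> ` (verts T \<times> B)"
            using c by (simp add: permutes_image[OF perm])
          then obtain a b where ab: "a \<in> verts T" "b \<in> B" "\<sigma> (a, b) = (a', c)"
            by auto
          then have "b = inv' q c"
            using snd_q[of a b] permutes_inverses(2)[OF q, of b] by simp
          then have "p c a = a'"
            using val(1)[of a c] ab c by simp
          then show "a' \<in> p c ` verts T"
            using ab by blast
        qed
      qed
    qed
    then show "p c permutes verts T"
      by (rule bij_imp_permutes) (simp add: p_def c)
    show "u \<rightarrow>\<^bsub>T\<^esub> v \<longleftrightarrow> p c u \<rightarrow>\<^bsub>T\<^esub> p c v" if "u \<in> verts T" "v \<in> verts T" for u v
      using forest_autsD(2)[OF \<sigma>, of "(u, inv' q c)" "(v, inv' q c)"] that c q_inv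
      by (simp add: val)
  qed
  then have p: "p \<in> carrier (product_group B (\<lambda>_. digraph_aut T))"
    by (auto simp: p_def)
  have "\<sigma> = wreath_base (verts T) B p \<circ> wreath_top (verts T) B q"
  proof
    fix z
    show "\<sigma> z = (wreath_base (verts T) B p \<circ> wreath_top (verts T) B q) z"
    proof (cases "z \<in> verts T \<times> B")
      case True
      then show ?thesis
        using val(1)[of "fst z" "q (snd z)"] permutes_in_image[OF q] permutes_inverses(2)[OF q]
        by (auto simp: wreath_base_def wreath_top_def)
    next
      case False
      then show ?thesis
        using permutes_not_in[OF perm False]
        by (cases z) (auto simp: wreath_base_def wreath_top_def)
    qed
  qed
  with p q show ?thesis
    by (rule that)
qed

lemma carrier_wreath_product_aut:
  "carrier (wreath_product (digraph_aut T) (verts T) (perm_group B) B) = forest_auts B"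
proof
  let ?P = "perm_group (verts T \<times> B)"
  let ?gens = "wreath_base (verts T) B ` carrier (product_group B (\<lambda>_. digraph_aut T))
     \<union> wreath_top (verts T) B ` carrier (perm_group B)"
  have gens: "?gens \<subseteq> forest_auts B"
    using wreath_base_in_forest_auts wreath_top_in_forest_auts
    by (auto simp only: perm_group_def partial_object.simps mem_Collect_eq)
  then show "carrier (wreath_product (digraph_aut T) (verts T) (perm_group B) B) \<subseteq> forest_auts B"
    unfolding wreath_product_def
    by (rule group.subgroup_generated_minimal[OF group_perm_group subgroup_forest_auts])
  have in_gen: "x \<in> generate ?P (carrier ?P \<inter> ?gens)" if "x \<in> ?gens" for x
    using that gens subgroup.subset[OF subgroup_forest_auts] by (intro generate.incl) blast
  show "forest_auts B \<subseteq> carrier (wreath_product (digraph_aut T) (verts T) (perm_group B) B)"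
  proof
    fix \<sigma> assume "\<sigma> \<in> forest_auts B"
    then obtain p q where "p \<in> carrier (product_group B (\<lambda>_. digraph_aut T))" "q permutes B"
      and \<sigma>: "\<sigma> = wreath_base (verts T) B p \<circ> wreath_top (verts T) B q"
      by (rule forest_aut_decomp)
    then have "wreath_base (verts T) B p \<in> ?gens" "wreath_top (verts T) B q \<in> ?gens"
      by (auto simp: perm_group_def)
    from generate.eng[OF in_gen[OF this(1)] in_gen[OF this(2)]]
    show "\<sigma> \<in> carrier (wreath_product (digraph_aut T) (verts T) (perm_group B) B)"
      by (simp add: wreath_product_def carrier_subgroup_generated \<sigma>) (simp add: perm_group_def)
  qed
qed

end

section \<open>A root with isomorphic branches\<close>

text \<open>The digraph \<open>G\<close> consists of a root \<open>r\<close> and of copies of \<open>T\<close> indexed by \<open>B\<close>, identified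
  with parts of \<open>G\<close> by \<open>\<phi>\<close>, whose roots are joined to \<open>r\<close>.\<close>

locale branch_copies = sink_digraph T t + G: nomulti_digraph G
  for T :: "('a, 'e) pre_digraph" and t :: 'a and G :: "('c, 'f) pre_digraph" +
  fixes r :: 'c and B :: "'b set" and \<phi> :: "'a \<times> 'b \<Rightarrow> 'c"
  assumes root_in_verts: "r \<in> verts G"
    and root_no_out: "\<not> r \<rightarrow>\<^bsub>G\<^esub> x"
    and bij_branches: "bij_betw \<phi> (verts T \<times> B) (verts G - {r})"
    and adj_branches: "\<lbrakk>z \<in> verts T \<times> B; w \<in> verts T \<times> B\<rbrakk> \<Longrightarrow>
      \<phi> z \<rightarrow>\<^bsub>G\<^esub> \<phi> w \<longleftrightarrow> snd z = snd w \<and> fst z \<rightarrow>\<^bsub>T\<^esub> fst w"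
    and adj_root: "z \<in> verts T \<times> B \<Longrightarrow> \<phi> z \<rightarrow>\<^bsub>G\<^esub> r \<longleftrightarrow> fst z = t"
begin

lemma branch_verts:
  assumes "z \<in> verts T \<times> B"
  shows "\<phi> z \<in> verts G" "\<phi> z \<noteq> r"
  using bij_betw_imp_surj_on[OF bij_branches] assms by blast+

lemma branch_inj: "\<lbrakk>z \<in> verts T \<times> B; w \<in> verts T \<times> B\<rbrakk> \<Longrightarrow> \<phi> z = \<phi> w \<longleftrightarrow> z = w"
  using bij_betw_imp_inj_on[OF bij_branches] by (auto dest: inj_onD)

lemma vert_cases:
  assumes "x \<in> verts G"
  obtains "x = r" | z where "z \<in> verts T \<times> B" "x = \<phi> z"
proof (cases "x = r")
  case False
  then have "x \<in> \<phi> ` (verts T \<times> B)"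
    using assms by (simp add: bij_betw_imp_surj_on[OF bij_branches])
  then show ?thesis
    using that(2) by blast
qed (rule that(1))

text \<open>A vertex of a branch reaches the root of the branch, which is joined to \<open>r\<close>. So every
  automorphism of \<open>G\<close> fixes \<open>r\<close> and acts on the union of the branches.\<close>

sublocale G: sink_digraph G r
proof unfold_locales
  fix x assume "x \<in> verts G"
  then show "(x, r) \<in> (arcs_ends G)\<^sup>*"
  proof (cases rule: vert_cases)
    case (2 z)
    obtain a b where z: "z = (a, b)" by force
    have b: "b \<in> B" and a: "a \<in> verts T" using 2 z by auto
    from reaches_sink[OF a] have "(\<phi> (a, b), r) \<in> (arcs_ends G)\<^sup>*"
    proof (induction rule: converse_rtrancl_induct)
      case base
      then show ?case
        using adj_root[of "(t, b)"] b sink_in_verts by auto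
    next
      case (step y y')
      then have "\<phi> (y, b) \<rightarrow>\<^bsub>G\<^esub> \<phi> (y', b)"
        using adj_branches[of "(y, b)" "(y', b)"] b adj_in_verts by auto
      then show ?case
        using step.IH by (rule converse_rtrancl_into_rtrancl)
    qed
    with 2 z show ?thesis by simp
  qed simp
qed (use root_in_verts root_no_out in auto)

text \<open>Conjugation by \<open>\<phi>\<close>, extended by the identity because permutations of a set are total
  functions.\<close>

definition transport :: "('c \<Rightarrow> 'c) \<Rightarrow> 'a \<times> 'b \<Rightarrow> 'a \<times> 'b" where
  "transport p z =
     (if z \<in> verts T \<times> B then inv_into (verts T \<times> B) \<phi> (p (\<phi> z)) else z)"

lemma aut_image_branch:
  assumes p: "p \<in> carrier (digraph_aut G)" and z: "z \<in> verts T \<times> B"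
  shows "transport p z \<in> verts T \<times> B" "\<phi> (transport p z) = p (\<phi> z)"
proof -
  have "p permutes verts G"
    using p by (simp add: digraph_aut_iff[OF G.nomulti_digraph_axioms])
  then have "p (\<phi> z) \<in> verts G - {r}"
    using branch_verts[OF z] G.aut_fixes_sink[OF p, of "\<phi> z"] by (simp add: permutes_in_image)
  then have *: "p (\<phi> z) \<in> \<phi> ` (verts T \<times> B)"
    by (simp add: bij_betw_imp_surj_on[OF bij_branches])
  show "transport p z \<in> verts T \<times> B" "\<phi> (transport p z) = p (\<phi> z)"
    using inv_into_into[OF *] f_inv_into_f[OF *] z by (simp_all add: transport_def)
qed

lemma transport_eqI:
  assumes "p \<in> carrier (digraph_aut G)"
    and "\<And>z. z \<in> verts T \<times> B \<Longrightarrow> \<sigma> z \<in> verts T \<times> B \<and> \<phi> (\<sigma> z) = p (\<phi> z)"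
    and "\<And>z. z \<notin> verts T \<times> B \<Longrightarrow> \<sigma> z = z"
  shows "transport p = \<sigma>"
proof
  fix z
  show "transport p z = \<sigma> z"
  proof (cases "z \<in> verts T \<times> B")
    case True
    have "\<phi> (transport p z) = \<phi> (\<sigma> z)"
      using aut_image_branch(2)[OF assms(1) True] assms(2)[OF True] by simp
    then show ?thesis
      using branch_inj[OF aut_image_branch(1)[OF assms(1) True], of "\<sigma> z"] assms(2)[OF True]
      by simp
  qed (auto simp: assms(3) transport_def)
qed

lemma transport_in_forest_auts:
  assumes p: "p \<in> carrier (digraph_aut G)"
  shows "transport p \<in> forest_auts B"
proof -
  have perm: "p permutes verts G"
    and adj: "\<And>u v. u \<in> verts G \<Longrightarrow> v \<in> verts G \<Longrightarrow> u \<rightarrow>\<^bsub>G\<^esub> v \<longleftrightarrow> p u \<rightarrow>\<^bsub>G\<^esub> p v"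
    using p by (auto simp: digraph_aut_iff[OF G.nomulti_digraph_axioms])
  note im = aut_image_branch[OF p]
  have pr: "p r = r"
    using G.aut_fixes_sink[OF p root_in_verts] by simp
  show ?thesis
    unfolding forest_auts_def
  proof (intro CollectI conjI ballI)
    have "bij_betw (transport p) (verts T \<times> B) (verts T \<times> B)"
    proof (rule bij_betw_imageI)
      show "inj_on (transport p) (verts T \<times> B)"
      proof (rule inj_onI)
        fix z w assume zw: "z \<in> verts T \<times> B" "w \<in> verts T \<times> B" "transport p z = transport p w"
        then have "p (\<phi> z) = p (\<phi> w)"
          using im(2) by metis
        then have "\<phi> z = \<phi> w"
          using permutes_inj[OF perm] by (auto dest: injD)
        then show "z = w"
          using zw by (simp only: branch_inj)
      qed
      show "transport p ` (verts T \<times> B) = verts T \<times> B"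
      proof
        show "transport p ` (verts T \<times> B) \<subseteq> verts T \<times> B"
          using im(1) by blast
        show "verts T \<times> B \<subseteq> transport p ` (verts T \<times> B)"
        proof
          fix w assume w: "w \<in> verts T \<times> B"
          then have "\<phi> w \<in> p ` verts G"
            using branch_verts by (simp add: permutes_image[OF perm])
          then obtain x where x: "x \<in> verts G" "p x = \<phi> w" by auto
          then obtain z where z: "z \<in> verts T \<times> B" "x = \<phi> z"
            using branch_verts(2)[OF w] pr by (metis vert_cases)
          then have "\<phi> (transport p z) = \<phi> w"
            using im(2) x by simp
          then have "transport p z = w"
            using im(1)[OF z(1)] w by (simp only: branch_inj)
          then show "w \<in> transport p ` (verts T \<times> B)"
            using z by blast
        qed
      qed
    qed
    then show "transport p permutes verts T \<times> B"
      by (rule bij_imp_permutes) (auto simp: transport_def)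
    show "(snd z = snd w \<and> fst z \<rightarrow>\<^bsub>T\<^esub> fst w) \<longleftrightarrow>
        (snd (transport p z) = snd (transport p w) \<and> fst (transport p z) \<rightarrow>\<^bsub>T\<^esub> fst (transport p w))"
      if "z \<in> verts T \<times> B" "w \<in> verts T \<times> B" for z w
      using adj[of "\<phi> z" "\<phi> w"] adj_branches[OF that] that branch_verts
        adj_branches[OF im(1)[OF that(1)] im(1)[OF that(2)]]
      by (simp add: im(2))
    show "fst (transport p z) = t \<longleftrightarrow> fst z = t" if "z \<in> verts T \<times> B" for z
      using adj[of "\<phi> z" r] adj_root[OF that] adj_root[OF im(1)[OF that]] that
        branch_verts root_in_verts
      by (simp add: im(2) pr)
  qed
qed

text \<open>Conjugation back, with \<open>r\<close> kept fixed, yields an automorphism: the arcs into \<open>r\<close> are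
  preserved because roots of copies go to roots of copies.\<close>

lemma forest_aut_transported:
  assumes \<sigma>: "\<sigma> \<in> forest_auts B"
  shows "\<exists>p\<in>carrier (digraph_aut G). transport p = \<sigma>"
proof -
  note perm = forest_autsD(1)[OF \<sigma>]
  have im: "\<sigma> z \<in> verts T \<times> B" if "z \<in> verts T \<times> B" for z
    using that permutes_in_image[OF perm] by blast
  define p where "p x =
    (if x \<in> verts G - {r} then \<phi> (\<sigma> (inv_into (verts T \<times> B) \<phi> x)) else x)" for x
  have val: "p (\<phi> z) = \<phi> (\<sigma> z)" if "z \<in> verts T \<times> B" for z
    using that branch_verts inv_into_f_f[OF bij_betw_imp_inj_on[OF bij_branches]]
    by (simp add: p_def)
  have pr: "p r = r"
    by (simp add: p_def)
  have "bij_betw (\<phi> \<circ> (\<sigma> \<circ> inv_into (verts T \<times> B) \<phi>)) (verts G - {r}) (verts G - {r})"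
    using bij_branches permutes_imp_bij[OF perm] bij_betw_inv_into[OF bij_branches]
    by (intro bij_betw_trans)
  then have "bij_betw p (verts G - {r}) (verts G - {r})"
    by (rule bij_betw_cong[THEN iffD1, rotated]) (simp add: p_def)
  then have "p permutes verts G - {r}"
    by (rule bij_imp_permutes) (simp only: p_def if_False)
  then have "p permutes verts G"
    by (rule permutes_subset) blast
  moreover have "u \<rightarrow>\<^bsub>G\<^esub> v \<longleftrightarrow> p u \<rightarrow>\<^bsub>G\<^esub> p v" if "u \<in> verts G" "v \<in> verts G" for u v
    using that(1)
  proof (cases rule: vert_cases)
    case 1
    then show ?thesis
      by (simp add: pr root_no_out)
  next
    case u: (2 z)
    from that(2) show ?thesis
    proof (cases rule: vert_cases)
      case 1
      then show ?thesis
        using u adj_root[OF u(1)] adj_root[OF im[OF u(1)]] forest_autsD(3)[OF \<sigma> u(1)]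
        by (simp add: val pr)
    next
      case v: (2 w)
      then show ?thesis
        using u adj_branches[OF u(1) v(1)] adj_branches[OF im[OF u(1)] im[OF v(1)]]
          forest_autsD(2)[OF \<sigma> u(1) v(1)]
        by (simp add: val)
    qed
  qed
  ultimately have p: "p \<in> carrier (digraph_aut G)"
    by (simp add: digraph_aut_iff[OF G.nomulti_digraph_axioms])
  have "transport p = \<sigma>"
    using p by (rule transport_eqI) (simp_all only: im val permutes_not_in[OF perm] simp_thms)
  with p show ?thesis
    by blast
qed

text \<open>An automorphism of \<open>G\<close> fixes \<open>r\<close> and the points outside \<open>G\<close>, so it is determined by
  its action on the branches, which may be any automorphism of the forest.\<close>

theorem digraph_aut_iso_wreath_product:
  "digraph_aut G \<cong> wreath_product (digraph_aut T) (verts T) (perm_group B) B"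
proof -
  have mult: "x \<otimes>\<^bsub>wreath_product (digraph_aut T) (verts T) (perm_group B) B\<^esub> y = x \<circ> y"
    "p \<otimes>\<^bsub>digraph_aut G\<^esub> q = p \<circ> q" for x y p q
    by (simp_all add: wreath_product_def subgroup_generated_def perm_group_def digraph_aut_def)
  have "transport \<in> iso (digraph_aut G)
      (wreath_product (digraph_aut T) (verts T) (perm_group B) B)"
    unfolding iso_def hom_def mult carrier_wreath_product_aut
  proof (intro CollectI conjI ballI)
    show "transport \<in> carrier (digraph_aut G) \<rightarrow> forest_auts B"
      using transport_in_forest_auts by blast
    show "transport (p \<circ> q) = transport p \<circ> transport q"
      if "p \<in> carrier (digraph_aut G)" "q \<in> carrier (digraph_aut G)" for p q
    proof (rule transport_eqI)
      show "p \<circ> q \<in> carrier (digraph_aut G)"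
        using that by (rule G.aut_comp)
      show "(transport p \<circ> transport q) z \<in> verts T \<times> B \<and>
          \<phi> ((transport p \<circ> transport q) z) = (p \<circ> q) (\<phi> z)" if "z \<in> verts T \<times> B" for z
        using aut_image_branch[OF \<open>p \<in> _\<close>] aut_image_branch[OF \<open>q \<in> _\<close> that]
        by (simp only: o_apply simp_thms)
    qed (simp only: transport_def o_apply if_False)
    show "bij_betw transport (carrier (digraph_aut G)) (forest_auts B)"
    proof (rule bij_betw_imageI)
      show "inj_on transport (carrier (digraph_aut G))"
      proof (rule inj_onI)
        fix p q assume p: "p \<in> carrier (digraph_aut G)" and q: "q \<in> carrier (digraph_aut G)"
          and eq: "transport p = transport q"
        show "p = q"
        proof
          fix x
          show "p x = q x"
          proof (cases "x \<in> verts G")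
            case True
            then show ?thesis
            proof (cases rule: vert_cases)
              case 1
              then show ?thesis
                using G.aut_fixes_sink[OF p root_in_verts] G.aut_fixes_sink[OF q root_in_verts]
                by simp
            next
              case (2 z)
              then show ?thesis
                using aut_image_branch(2)[OF p 2(1)] aut_image_branch(2)[OF q 2(1)] eq by simp
            qed
          next
            case False
            then show ?thesis
              using p q permutes_not_in[of p "verts G" x] permutes_not_in[of q "verts G" x]
              unfolding digraph_aut_iff[OF G.nomulti_digraph_axioms] by metis
          qed
        qed
      qed
      show "transport ` carrier (digraph_aut G) = forest_auts B"
        using transport_in_forest_auts forest_aut_transported by blast
    qed
  qed
  then show ?thesis
    unfolding is_iso_def by blast
qed

end

section \<open>Heights and powers in a cyclic group\<close>

text \<open>If \<open>g\<close> generates the group of order \<open>d e\<close>, then \<open>g\<^sup>i\<close> is a root exactly when \<open>e\<close> divides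
  \<open>i\<close>, so the roots form the subgroup generated by \<open>g\<^sup>e\<close>, an element of order \<open>d\<close>.\<close>

lemma (in group) card_roots_of_unity_cyclic:
  assumes cyc: "cyclic_group G" and fin: "finite (carrier G)" and d: "d dvd order G"
  shows "card {x \<in> carrier G. x [^] d = \<one>} = d"
proof -
  obtain g where g: "g \<in> carrier G" "subgroup_generated G {g} = G"
    using cyc by (auto simp: cyclic_group_def)
  have n: "order G > 0"
    using fin by (simp add: order_gt_0_iff_finite)
  have ord_g: "ord g = order G"
    using cyclic_order_is_ord[OF g(1)] g(2) by simp
  obtain e where e: "order G = d * e"
    using d by blast
  have pos: "d > 0" "e > 0"
    using n e by simp_all
  define c where "c = g [^] e"
  have c: "c \<in> carrier G"
    using g by (simp add: c_def)
  have ord_c: "ord c = d"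
    unfolding c_def using ord_pow[of g e] g pos by (simp add: ord_g e)
  have "{x \<in> carrier G. x [^] d = \<one>} = generate G {c}"
  proof
    show "{x \<in> carrier G. x [^] d = \<one>} \<subseteq> generate G {c}"
    proof
      fix x assume x: "x \<in> {x \<in> carrier G. x [^] d = \<one>}"
      have "carrier G = generate G {g}"
        using arg_cong[OF g(2), of carrier] g(1) by (simp add: carrier_subgroup_generated)
      then obtain i :: nat where i: "x = g [^] i"
        using x generate_pow_nat[OF g(1)] ord_g n by auto
      then have "d * e dvd i * d"
        using x g pow_eq_id[OF g(1), of "i * d"] by (simp add: nat_pow_pow ord_g e)
      then have "e dvd i"
        using pos by (simp add: mult.commute)
      then obtain j where "i = e * j" ..
      then have "x = c [^] j"
        using g by (simp add: i c_def nat_pow_pow)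
      then show "x \<in> generate G {c}"
        using generate_pow_nat[OF c] ord_c pos by auto
    qed
    show "generate G {c} \<subseteq> {x \<in> carrier G. x [^] d = \<one>}"
      using generate_pow_nat[OF c] c ord_c pos pow_eq_id[OF c]
      by (auto simp: nat_pow_pow)
  qed
  then show ?thesis
    using generate_pow_card[OF c] ord_c by simp
qed

locale cyclic_prime_power = group H for H (structure) +
  fixes k :: nat
  assumes cyclic: "cyclic_group H"
    and finite_carrier: "finite (carrier H)"
    and prime: "prime k"
    and k_dvd_order: "k dvd order H"
begin

abbreviation T1 :: "'a set" where "T1 \<equiv> tree_one_verts H k"
abbreviation ht :: "'a \<Rightarrow> nat" where "ht \<equiv> height H k"

lemma T1_carrier: "x \<in> T1 \<Longrightarrow> x \<in> carrier H"
  by (simp add: tree_one_verts_def)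

lemma one_in_T1: "\<one> \<in> T1"
  by (simp add: tree_one_verts_def)

lemma finite_T1: "finite T1"
  using finite_carrier by (simp add: tree_one_verts_def)

lemma pow_pow_commute:
  fixes i j :: nat
  shows "x \<in> carrier H \<Longrightarrow> (x [^] i) [^] j = (x [^] j) [^] i"
  by (simp add: nat_pow_pow mult.commute)

lemma pow_in_T1:
  fixes i :: nat
  assumes "x \<in> T1"
  shows "x [^] i \<in> T1"
proof -
  obtain m where xH: "x \<in> carrier H" and m: "x [^] (k ^ m) = \<one>"
    using assms by (auto simp: tree_one_verts_def)
  have "(x [^] i) [^] (k ^ m) = \<one>"
    using m by (simp only: pow_pow_commute[OF xH, of i] nat_pow_one)
  then show ?thesis
    using xH unfolding tree_one_verts_def by blast
qed

lemma pow_eq_one_iff_height: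
  assumes "x \<in> T1"
  shows "x [^] (k ^ m) = \<one> \<longleftrightarrow> ht x \<le> m"
proof
  show "ht x \<le> m" if "x [^] (k ^ m) = \<one>"
    unfolding height_def using that by (rule Least_le)
  have "x [^] (k ^ ht x) = \<one>"
    using assms unfolding height_def by (auto simp: tree_one_verts_def intro: LeastI)
  then have "x [^] (k ^ (ht x + (m - ht x))) = \<one>"
    using T1_carrier[OF assms] by (simp add: power_add flip: nat_pow_pow)
  then show "x [^] (k ^ m) = \<one>" if "ht x \<le> m"
    using that by simp
qed

lemma height_eq_0_iff: "x \<in> T1 \<Longrightarrow> ht x = 0 \<longleftrightarrow> x = \<one>"
  using pow_eq_one_iff_height[of x 0] T1_carrier[of x] by simp

lemma height_pow:
  assumes "x \<in> T1"
  shows "ht (x [^] (k ^ j)) = ht x - j"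
proof -
  have "ht (x [^] (k ^ j)) \<le> m \<longleftrightarrow> ht x - j \<le> m" for m
    using pow_eq_one_iff_height[OF assms, of "j + m"] T1_carrier[OF assms]
      pow_eq_one_iff_height[OF pow_in_T1[OF assms], of "k ^ j" m]
    by (auto simp: nat_pow_pow power_add)
  then show ?thesis
    by (meson order_antisym order_refl)
qed

lemma height_le_max: "x \<in> T1 \<Longrightarrow> ht x \<le> max_height H k"
  unfolding max_height_def using finite_T1 by (intro Max_ge) auto

text \<open>The order divides \<open>k\<^sup>m\<close> exactly when the height is at most \<open>m\<close>; since \<open>k\<close> is prime,
  the order is itself a power of \<open>k\<close>.\<close>

lemma ord_eq_power_height:
  assumes "x \<in> T1"
  shows "ord x = k ^ ht x"
proof -
  have iff: "ord x dvd k ^ m \<longleftrightarrow> ht x \<le> m" for m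
    using pow_eq_one_iff_height[OF assms] pow_eq_id[OF T1_carrier[OF assms]] by simp
  then obtain i where "i \<le> ht x" "ord x = k ^ i"
    using divides_primepow_nat[OF prime] by blast
  with iff[of i] show ?thesis
    by simp
qed

text \<open>Both elements have order \<open>k\<^sup>h\<close>. The subgroup generated by \<open>b\<close> has \<open>k\<^sup>h\<close> elements, hence
  is the set of all elements whose order divides \<open>k\<^sup>h\<close>, and contains \<open>c\<close>. An exponent
  divisible by \<open>k\<close> would lower the height.\<close>

lemma same_height_imp_coprime_pow:
  assumes b: "b \<in> T1" and c: "c \<in> T1" and ht: "ht b = ht c" "ht b \<ge> 1"
  shows "\<exists>u::nat. coprime u k \<and> c = b [^] u"
proof -
  let ?R = "{x \<in> carrier H. x [^] (k ^ ht b) = \<one>}"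
  note bH = T1_carrier[OF b] and ord_b = ord_eq_power_height[OF b]
  have ord_pos: "ord b \<noteq> 0"
    using prime by (simp add: ord_b prime_gt_0_nat)
  note gen = generate_pow_nat[OF bH ord_pos]
  have "(b [^] j) [^] (k ^ ht b) = \<one>" for j :: nat
    using pow_ord_eq_1[OF bH] by (simp only: ord_b pow_pow_commute[OF bH, of j] nat_pow_one)
  then have "generate H {b} \<subseteq> ?R"
    using bH by (auto simp: gen)
  moreover have "card (generate H {b}) = card ?R"
    using card_roots_of_unity_cyclic[OF cyclic finite_carrier, of "k ^ ht b"]
      ord_dvd_group_order[OF bH] generate_pow_card[OF bH] by (simp add: ord_b)
  ultimately have "generate H {b} = ?R"
    using finite_carrier by (intro card_subset_eq) auto
  moreover have "c \<in> ?R"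
    using T1_carrier[OF c] pow_eq_one_iff_height[OF c] ht by simp
  ultimately obtain u :: nat where u: "c = b [^] u"
    unfolding gen by auto
  have "\<not> k dvd u"
  proof
    assume "k dvd u"
    then obtain w where "u = k * w" ..
    then have "u * k ^ (ht b - 1) = k ^ ht b * w"
      using ht(2) by (cases "ht b") simp_all
    then have "c [^] (k ^ (ht b - 1)) = (b [^] (k ^ ht b)) [^] w"
      using bH by (simp add: u nat_pow_pow)
    also have "\<dots> = \<one>"
      using pow_eq_one_iff_height[OF b, of "ht b"] by simp
    finally show False
      using pow_eq_one_iff_height[OF c] ht by simp
  qed
  then have "coprime u k"
    using prime_imp_coprime[OF prime] coprime_commute by blast
  with u show ?thesis
    by blast
qed

text \<open>The inverse exponent is an inverse of \<open>u\<close> modulo \<open>k\<^sup>M\<close>, where \<open>M\<close> is the maximal height,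
  since the orders of all vertices divide \<open>k\<^sup>M\<close>.\<close>

lemma coprime_pow_invertible:
  assumes "coprime u k"
  shows "\<exists>v::nat. \<forall>x\<in>T1. (x [^] u) [^] v = x"
proof -
  let ?K = "k ^ max_height H k"
  obtain v where "[u * v = Suc 0] (mod ?K)"
    using cong_solve_coprime_nat[of u ?K] assms by auto
  \<comment> \<open>Modulo 1 the congruence says nothing, but then \<open>T1\<close> is trivial.\<close>
  then obtain q where q: "?K = 1 \<or> u * v = 1 + q * ?K"
    unfolding One_nat_def[symmetric] cong_to_1'_nat by blast
  have "(x [^] u) [^] v = x" if x: "x \<in> T1" for x
  proof -
    have xH: "x \<in> carrier H" and one: "x [^] ?K = \<one>"
      using T1_carrier[OF x] pow_eq_one_iff_height[OF x] height_le_max[OF x] by simp_all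
    show ?thesis
    proof (cases "?K = 1")
      case True
      show ?thesis
        using one[unfolded True] xH by simp
    next
      case False
      then have "x [^] (u * v) = (x [^] ?K) [^] q \<otimes> x"
        using q xH by (simp add: nat_pow_pow mult.commute flip: nat_pow_mult)
      then show ?thesis
        using one xH by (simp add: nat_pow_pow)
    qed
  qed
  then show ?thesis
    by blast
qed

section \<open>Subtrees of the power digraph\<close>

definition descendants :: "'a \<Rightarrow> 'a set" where
  "descendants a = {x \<in> carrier H. \<exists>j. x [^] (k ^ j) = a}"

text \<open>The exponent \<open>j\<close> with \<open>x\<close> raised to \<open>k\<^sup>j\<close> equal to \<open>a\<close> can be taken to be the difference of
  the heights. For \<open>a \<noteq> \<one>\<close> it is the only one; at the identity any larger one works as well.\<close>

lemma descendants_iff: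
  assumes a: "a \<in> T1"
  shows "x \<in> descendants a \<longleftrightarrow> x \<in> T1 \<and> ht a \<le> ht x \<and> x [^] (k ^ (ht x - ht a)) = a"
proof
  assume "x \<in> descendants a"
  then obtain j where x: "x \<in> carrier H" and j: "x [^] (k ^ j) = a"
    by (auto simp: descendants_def)
  have "x [^] (k ^ (j + ht a)) = \<one>"
    using x j pow_eq_one_iff_height[OF a, of "ht a"] by (simp add: power_add flip: nat_pow_pow)
  then have xT: "x \<in> T1"
    using x unfolding tree_one_verts_def by blast
  have h: "ht a = ht x - j"
    using height_pow[OF xT, of j] j by simp
  moreover have "x [^] (k ^ (ht x - ht a)) = a"
  proof (cases "j \<le> ht x")
    case True
    then show ?thesis using h j by simp
  next
    case False
    then have "ht a = 0" using h by simp
    then show ?thesis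
      using height_eq_0_iff[OF a] pow_eq_one_iff_height[OF xT] by simp
  qed
  ultimately show "x \<in> T1 \<and> ht a \<le> ht x \<and> x [^] (k ^ (ht x - ht a)) = a"
    using xT by simp
qed (auto simp: descendants_def T1_carrier)

lemma descendants_pow:
  fixes u :: nat
  assumes "x \<in> descendants b"
  shows "x [^] u \<in> descendants (b [^] u)"
proof -
  obtain j where xH: "x \<in> carrier H" and j: "x [^] (k ^ j) = b"
    using assms by (auto simp: descendants_def)
  have "(x [^] u) [^] (k ^ j) = b [^] u"
    by (simp only: pow_pow_commute[OF xH, of u] j)
  then show ?thesis
    using xH unfolding descendants_def by blast
qed

lemma self_descendant: "a \<in> T1 \<Longrightarrow> a \<in> descendants a"
  by (simp add: descendants_iff T1_carrier)

lemma descendant_of_one: "descendants \<one> = T1"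
  using pow_eq_one_iff_height height_eq_0_iff[OF one_in_T1] by (auto simp: descendants_iff one_in_T1)

lemma proper_descendant_height:
  assumes "a \<in> T1" "x \<in> descendants a" "x \<noteq> a"
  shows "ht a < ht x"
  using assms by (auto simp: descendants_iff T1_carrier order.strict_iff_order)

lemma proper_descendant_pow:
  assumes a: "a \<in> T1" and x: "x \<in> descendants a" "x \<noteq> a"
  shows "x [^] k \<in> descendants a"
proof -
  have xT: "x \<in> T1" and pow: "x [^] (k ^ (ht x - ht a)) = a"
    using x a by (simp_all add: descendants_iff)
  obtain j where j: "ht x - ht a = Suc j"
    using proper_descendant_height[OF a x] by (metis Suc_diff_Suc)
  have "(x [^] k) [^] (k ^ j) = a"
    using pow T1_carrier[OF xT] by (simp add: j nat_pow_pow)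
  then show ?thesis
    using T1_carrier[OF xT] by (auto simp: descendants_def)
qed

text \<open>Since \<open>T\<^sub>1\<close> is defined with its loop deleted, it differs from the tree originating from
  the identity; for the recursion both kinds of tree are treated alike.\<close>

definition tree_at :: "'a \<Rightarrow> ('a, 'a \<times> 'a) pre_digraph" where
  "tree_at a = (if a = \<one> then tree_one H k else tree_from H k a)"

lemma verts_tree_at: "verts (tree_at a) = descendants a"
proof (cases "a = \<one>")
  case True
  then show ?thesis
    by (simp add: tree_at_def descendant_of_one tree_one_def pre_digraph.del_arc_def)
qed (simp add: tree_at_def tree_from_def descendants_def)

text \<open>At the identity the loop is deleted explicitly; at any other vertex \<open>a\<close> the induced subgraph
  has no arc leaving \<open>a\<close>, because \<open>a\<^sup>k\<close> has smaller height and so is not a descendant.\<close>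

lemma adj_tree_at:
  assumes a: "a \<in> T1"
  shows "x \<rightarrow>\<^bsub>tree_at a\<^esub> y \<longleftrightarrow> x \<in> descendants a \<and> x \<noteq> a \<and> y = x [^] k"
proof (cases "a = \<one>")
  case True
  have "x \<rightarrow>\<^bsub>tree_one H k\<^esub> y \<longleftrightarrow> x \<in> T1 \<and> x \<noteq> \<one> \<and> y = x [^] k"
    by (auto simp: arcs_ends_conv tree_one_def pre_digraph.del_arc_def power_digraph_def
        induce_subgraph_def T1_carrier pow_in_T1 image_iff)
  then show ?thesis
    using True by (simp add: tree_at_def descendant_of_one)
next
  case False
  have "\<not> ht a \<le> ht (a [^] k)"
    using height_pow[OF a, of 1] False height_eq_0_iff[OF a] by simp
  then have "a [^] k \<notin> descendants a"
    using a by (simp add: descendants_iff)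
  moreover have "x \<rightarrow>\<^bsub>tree_from H k a\<^esub> y \<longleftrightarrow>
      x \<in> descendants a \<and> y \<in> descendants a \<and> y = x [^] k"
    by (auto simp: arcs_ends_conv tree_from_def power_digraph_def
        induce_subgraph_def descendants_def image_iff)
  ultimately show ?thesis
    using False proper_descendant_pow[OF a] by (auto simp: tree_at_def)
qed

lemma nomulti_tree_at: "nomulti_digraph (tree_at a)"
  by (simp add: tree_at_def nomulti_digraph_trees group_axioms)

lemma sink_digraph_tree_at:
  assumes a: "a \<in> T1"
  shows "sink_digraph (tree_at a) a"
proof (rule sink_digraph.intro[OF nomulti_tree_at], unfold_locales)
  show "a \<in> verts (tree_at a)"
    by (simp add: verts_tree_at self_descendant a)
  show "\<not> a \<rightarrow>\<^bsub>tree_at a\<^esub> x" for x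
    by (simp add: adj_tree_at a)
  fix x assume "x \<in> verts (tree_at a)"
  then show "(x, a) \<in> (arcs_ends (tree_at a))\<^sup>*"
    unfolding verts_tree_at
  proof (induction "ht x" arbitrary: x rule: less_induct)
    case less
    show ?case
    proof (cases "x = a")
      case False
      have "x \<in> T1"
        using less.prems a by (simp add: descendants_iff)
      then have "ht (x [^] k) < ht x"
        using proper_descendant_height[OF a less.prems False] height_pow[of x 1] by simp
      then have "(x [^] k, a) \<in> (arcs_ends (tree_at a))\<^sup>*"
        using proper_descendant_pow[OF a less.prems False] by (rule less.hyps)
      moreover have "x \<rightarrow>\<^bsub>tree_at a\<^esub> (x [^] k)"
        using less.prems False by (simp add: adj_tree_at a)
      ultimately show ?thesis
        by (rule converse_rtrancl_into_rtrancl[rotated])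
    qed simp
  qed
qed

text \<open>At the identity, the condition \<open>x \<noteq> a\<close> accounts for the deleted loop.\<close>

definition children :: "'a \<Rightarrow> 'a set" where
  "children a = {x \<in> T1. x [^] k = a \<and> x \<noteq> a}"

lemma height_child:
  assumes a: "a \<in> T1" and c: "c \<in> children a"
  shows "ht c = ht a + 1"
proof -
  have cT: "c \<in> T1" "c [^] k = a" "c \<noteq> a"
    using c by (simp_all add: children_def)
  have "ht c \<noteq> 0"
    using cT height_eq_0_iff[OF cT(1)] by auto
  then show ?thesis
    using height_pow[OF cT(1), of 1] cT(2) by simp
qed

lemma child_descendants:
  assumes a: "a \<in> T1" and c: "c \<in> children a"
  shows "descendants c \<subseteq> descendants a - {a}"
proof
  fix x assume x: "x \<in> descendants c"
  have cT: "c \<in> T1" "c [^] k = a"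
    using c by (simp_all add: children_def)
  have "ht a < ht x"
    using x height_child[OF a c] cT by (simp add: descendants_iff)
  obtain j where xH: "x \<in> carrier H" and "x [^] (k ^ j) = c"
    using x by (auto simp: descendants_def)
  then have "x [^] (k ^ Suc j) = a"
    using cT(2) by (simp add: mult.commute[of k] flip: nat_pow_pow)
  then show "x \<in> descendants a - {a}"
    using xH \<open>ht a < ht x\<close> unfolding descendants_def by blast
qed

lemma proper_descendant_below_child:
  assumes a: "a \<in> T1" and x: "x \<in> descendants a" "x \<noteq> a"
  obtains c where "c \<in> children a" "x \<in> descendants c"
proof -
  have xT: "x \<in> T1" and pow: "x [^] (k ^ (ht x - ht a)) = a"
    using x a by (simp_all add: descendants_iff)
  obtain j where j: "ht x - ht a = Suc j"
    using proper_descendant_height[OF a x] by (metis Suc_diff_Suc)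
  define c where "c = x [^] (k ^ j)"
  have "c \<in> T1"
    unfolding c_def by (rule pow_in_T1[OF xT])
  moreover have "c [^] k = a"
    using pow T1_carrier[OF xT] by (simp add: c_def j nat_pow_pow mult.commute)
  moreover have "c \<noteq> a"
    using height_pow[OF xT, of j] j by (auto simp: c_def)
  ultimately have "c \<in> children a"
    by (simp add: children_def)
  moreover have "x \<in> descendants c"
    using T1_carrier[OF xT] by (auto simp: descendants_def c_def)
  ultimately show ?thesis
    by (rule that)
qed

text \<open>Children of one vertex have the same height, and a vertex has only one power of each
  height among its iterated \<open>k\<close>-th powers.\<close>

lemma child_branches_disjoint:
  assumes a: "a \<in> T1" and c: "c \<in> children a" "c' \<in> children a"
    and x: "x \<in> descendants c" "x \<in> descendants c'"
  shows "c = c'"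
  using x c height_child[OF a c(1)] height_child[OF a c(2)]
  by (auto simp: descendants_iff children_def)

section \<open>The recursion for the automorphism groups\<close>

text \<open>Write each child of \<open>a\<close> as a power of \<open>b\<close> with an exponent \<open>u i\<close> prime to \<open>k\<close>. Then
  \<open>x \<mapsto> x [^] u i\<close> identifies the tree at \<open>b\<close> with the branch of the \<open>i\<close>-th child. So \<open>b\<close>
  can be any vertex of the right height, whether or not it is a child of \<open>a\<close>.\<close>

lemma tree_at_iso_wreath_product:
  assumes a: "a \<in> T1" and b: "b \<in> T1" and ht: "ht b = ht a + 1"
  shows "digraph_aut (tree_at a) \<cong>
    wreath_product (digraph_aut (tree_at b)) (verts (tree_at b))
      (sym_group (card (children a))) {1..card (children a)}"
proof -
  let ?B = "{1..card (children a)}"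
  have "finite (children a)"
    using finite_T1 by (simp add: children_def)
  then obtain \<beta> where \<beta>: "bij_betw \<beta> ?B (children a)"
    using ex_bij_betw_nat_finite_1 by blast
  have child: "\<beta> i \<in> children a" if "i \<in> ?B" for i
    using bij_betwE[OF \<beta>] that by blast
  have childT: "\<beta> i \<in> T1" "\<beta> i [^] k = a" "ht (\<beta> i) = ht a + 1" if "i \<in> ?B" for i
    using child[OF that] height_child[OF a child[OF that]] by (simp_all add: children_def)
  have "\<forall>i\<in>?B. \<exists>u::nat. coprime u k \<and> \<beta> i = b [^] u"
    using same_height_imp_coprime_pow[OF b] childT ht by simp
  from bchoice[OF this] obtain u :: "nat \<Rightarrow> nat"
    where u: "coprime (u i) k" "\<beta> i = b [^] u i" if "i \<in> ?B" for i
    by blast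
  have "\<forall>i\<in>?B. \<exists>v::nat. \<forall>x\<in>T1. (x [^] u i) [^] v = x"
    by (intro ballI coprime_pow_invertible u(1))
  from bchoice[OF this] obtain v :: "nat \<Rightarrow> nat"
    where v: "(x [^] u i) [^] v i = x" if "i \<in> ?B" "x \<in> T1" for i x
    by blast
  have cancel: "x [^] u i = y [^] u i \<longleftrightarrow> x = y" if "i \<in> ?B" "x \<in> T1" "y \<in> T1" for i x y
    using v[OF that(1,2)] v[OF that(1,3)] by metis
  have in_T1: "x \<in> T1" if "x \<in> descendants b" for x
    using that b by (simp add: descendants_iff)
  have move: "x [^] u i \<in> descendants (\<beta> i)" if "i \<in> ?B" "x \<in> descendants b" for i x
    using descendants_pow[OF that(2), of "u i"] u(2)[OF that(1)] by simp
  have move': "x [^] u i \<in> descendants a" "x [^] u i \<noteq> a"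
    if "i \<in> ?B" "x \<in> descendants b" for i x
    using child_descendants[OF a child] move that by blast+
  have same_branch: "i = j"
    if "i \<in> ?B" "j \<in> ?B" "y \<in> descendants (\<beta> i)" "y \<in> descendants (\<beta> j)" for i j y
    using child_branches_disjoint[OF a child[OF that(1)] child[OF that(2)] that(3,4)] that(1,2)
      bij_betw_imp_inj_on[OF \<beta>] by (auto dest: inj_onD)
  interpret S: sink_digraph "tree_at b" b
    by (rule sink_digraph_tree_at[OF b])
  interpret R: sink_digraph "tree_at a" a
    by (rule sink_digraph_tree_at[OF a])
  interpret branch_copies "tree_at b" b "tree_at a" a ?B "\<lambda>(x, i). x [^] u i"
  proof unfold_locales
    show "a \<in> verts (tree_at a)" "\<not> a \<rightarrow>\<^bsub>tree_at a\<^esub> x" for x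
      by (rule R.sink_in_verts, rule R.sink_no_out)
    show "bij_betw (\<lambda>(x, i). x [^] u i) (verts (tree_at b) \<times> ?B) (verts (tree_at a) - {a})"
      unfolding verts_tree_at
    proof (rule bij_betw_imageI)
      show "inj_on (\<lambda>(x, i). x [^] u i) (descendants b \<times> ?B)"
      proof (rule inj_onI)
        fix z w
        assume zw: "z \<in> descendants b \<times> ?B" "w \<in> descendants b \<times> ?B"
          and im: "(case z of (x, i) \<Rightarrow> x [^] u i) = (case w of (x, i) \<Rightarrow> x [^] u i)"
        obtain x i y j where z: "z = (x, i)" and w: "w = (y, j)"
          by force
        have *: "x \<in> descendants b" "y \<in> descendants b" "i \<in> ?B" "j \<in> ?B"
          and eq: "x [^] u i = y [^] u j"
          using zw im by (auto simp: z w)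
        then have "i = j"
          using same_branch[of i j "x [^] u i"] move by metis
        then show "z = w"
          using eq cancel[OF *(4), of x y] * in_T1 by (simp add: z w)
      qed
      show "(\<lambda>(x, i). x [^] u i) ` (descendants b \<times> ?B) = descendants a - {a}"
      proof
        show "(\<lambda>(x, i). x [^] u i) ` (descendants b \<times> ?B) \<subseteq> descendants a - {a}"
          by (rule image_subsetI) (clarify, simp only: Diff_iff singleton_iff move' simp_thms)
        show "descendants a - {a} \<subseteq> (\<lambda>(x, i). x [^] u i) ` (descendants b \<times> ?B)"
        proof
          fix y assume "y \<in> descendants a - {a}"
          then obtain c where c: "c \<in> children a" "y \<in> descendants c"
            using proper_descendant_below_child[OF a] by blast
          then obtain i where i: "i \<in> ?B" "c = \<beta> i"
            using bij_betw_imp_surj_on[OF \<beta>] by blast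
          have yT: "y \<in> T1"
            using c by (simp add: children_def descendants_iff)
          have yH: "y \<in> carrier H"
            by (rule T1_carrier[OF yT])
          have "y [^] v i \<in> descendants b"
            using descendants_pow[OF c(2), of "v i"] v[OF i(1) b] u(2)[OF i(1)] i(2) by simp
          moreover have "y = (y [^] v i) [^] u i"
            using v[OF i(1) yT] pow_pow_commute[OF yH, of "u i" "v i"] by simp
          ultimately show "y \<in> (\<lambda>(x, i). x [^] u i) ` (descendants b \<times> ?B)"
            using i by force
        qed
      qed
    qed
    show "(case z of (x, i) \<Rightarrow> x [^] u i) \<rightarrow>\<^bsub>tree_at a\<^esub> (case w of (x, i) \<Rightarrow> x [^] u i)
        \<longleftrightarrow> snd z = snd w \<and> fst z \<rightarrow>\<^bsub>tree_at b\<^esub> fst w"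
      if "z \<in> verts (tree_at b) \<times> ?B" "w \<in> verts (tree_at b) \<times> ?B" for z w
    proof -
      obtain x i y j where zw: "z = (x, i)" "w = (y, j)" by force
      have x: "x \<in> descendants b" "i \<in> ?B" and y: "y \<in> descendants b" "j \<in> ?B"
        using that by (auto simp: zw verts_tree_at)
      note xT = in_T1[OF x(1)] and yT = in_T1[OF y(1)]
      have comm: "(x [^] u i) [^] k = (x [^] k) [^] u i"
        using T1_carrier[OF xT] by (rule pow_pow_commute)
      \<comment> \<open>An arc determines its branch: unless \<open>x = b\<close>, where the arc leads to the root \<open>a\<close>, both ends lie in it.\<close>
      have "y [^] u j = (x [^] k) [^] u i \<longleftrightarrow> i = j \<and> x \<noteq> b \<and> y = x [^] k"
      proof
        assume eq: "y [^] u j = (x [^] k) [^] u i"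
        have "x \<noteq> b"
        proof
          assume "x = b"
          then have "y [^] u j = a"
            using eq comm u(2)[OF x(2)] childT(2)[OF x(2)] by simp
          then show False
            using move'[OF y(2,1)] by simp
        qed
        then have "(x [^] k) [^] u i \<in> descendants (\<beta> i)"
          using move[OF x(2)] proper_descendant_pow[OF b x(1)] by blast
        then have "i = j"
          using same_branch[OF x(2) y(2), of "y [^] u j"] move[OF y(2,1)] eq by simp
        moreover from this have "y = x [^] k"
          using cancel[OF y(2) yT pow_in_T1[OF xT, of k]] eq by simp
        ultimately show "i = j \<and> x \<noteq> b \<and> y = x [^] k"
          using \<open>x \<noteq> b\<close> by simp
      qed simp
      then show ?thesis
        using x move'[OF x(2,1)] comm by (simp add: zw adj_tree_at a b)
    qed
    show "(case z of (x, i) \<Rightarrow> x [^] u i) \<rightarrow>\<^bsub>tree_at a\<^esub> a \<longleftrightarrow> fst z = b"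
      if "z \<in> verts (tree_at b) \<times> ?B" for z
    proof -
      obtain x i where z: "z = (x, i)" by force
      have x: "x \<in> descendants b" "i \<in> ?B"
        using that by (auto simp: z verts_tree_at)
      note xT = in_T1[OF x(1)] and im = move[OF x(2,1)]
      have "a = (x [^] u i) [^] k \<longleftrightarrow> x = b"
      proof
        assume "a = (x [^] u i) [^] k"
        then have "ht (x [^] u i) \<le> ht (\<beta> i)"
          using height_pow[OF pow_in_T1[OF xT, of "u i"], of 1] childT(3)[OF x(2)] by simp
        then have "x [^] u i = \<beta> i"
          using proper_descendant_height[OF childT(1)[OF x(2)] im] by fastforce
        then show "x = b"
          using u(2)[OF x(2)] cancel[OF x(2) xT b] by simp
      next
        assume "x = b"
        then show "a = (x [^] u i) [^] k"
          using u(2)[OF x(2)] childT(2)[OF x(2)] by simp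
      qed
      then show ?thesis
        using move'[OF x(2,1)] by (simp add: z adj_tree_at a)
    qed
  qed
  show ?thesis
    using digraph_aut_iso_wreath_product by (simp only: sym_group_eq_perm_group)
qed

lemma card_children_one: "card (children \<one>) = k - 1"
proof -
  have "x \<in> T1" if "x \<in> carrier H" "x [^] k = \<one>" for x
  proof -
    have "x [^] (k ^ 1) = \<one>" using that by simp
    then show ?thesis using that unfolding tree_one_verts_def by blast
  qed
  then have "children \<one> = {x \<in> carrier H. x [^] k = \<one>} - {\<one>}"
    by (auto simp: children_def T1_carrier)
  then show ?thesis
    using card_roots_of_unity_cyclic[OF cyclic finite_carrier k_dvd_order] by simp
qed

text \<open>Some vertex of the same height as \<open>a\<close> is a \<open>k\<close>-th power, namely of a vertex of height
  \<open>ht a + 1\<close>. As \<open>a\<close> is a power of it and power maps commute, \<open>a\<close> is a \<open>k\<close>-th power too.\<close>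

lemma ex_child:
  assumes a: "a \<in> T1" and ht: "1 \<le> ht a" "ht a < max_height H k"
  shows "\<exists>c\<in>T1. c [^] k = a"
proof -
  obtain c where c: "c \<in> T1" "ht c = ht a + 1"
    using ex_height[OF group_axioms finite_carrier, of "ht a + 1" k] ht(2) by auto
  have "ht (c [^] k) = ht a"
    using height_pow[OF c(1), of 1] c(2) by simp
  then obtain u :: nat where "a = (c [^] k) [^] u"
    using same_height_imp_coprime_pow[OF pow_in_T1[OF c(1), of k] a] ht(1) by auto
  then have "(c [^] u) [^] k = a"
    using T1_carrier[OF c(1)] by (simp add: pow_pow_commute[of c k])
  then show ?thesis
    using pow_in_T1[OF c(1)] by blast
qed

text \<open>Multiplication by one preimage maps the kernel of the power map onto the preimages.\<close>

lemma card_children: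
  assumes a: "a \<in> T1" and ht: "1 \<le> ht a" "ht a < max_height H k"
  shows "card (children a) = k"
proof -
  obtain c where cT: "c \<in> T1" and c: "c [^] k = a"
    using ex_child[OF assms] by blast
  note cH = T1_carrier[OF cT]
  interpret comm_group H
    by (rule cyclic_imp_abelian_group[OF cyclic])
  have preimages: "x \<in> children a \<longleftrightarrow> x \<in> carrier H \<and> x [^] k = a" for x
  proof
    assume x: "x \<in> carrier H \<and> x [^] k = a"
    then have "x [^] (k ^ 1) = a"
      by simp
    then have "x \<in> descendants a"
      using x unfolding descendants_def by blast
    then have xT: "x \<in> T1"
      using a by (simp add: descendants_iff)
    moreover have "x \<noteq> a"
      using x ht(1) height_pow[OF xT, of 1] by auto
    ultimately show "x \<in> children a"
      using x by (simp add: children_def)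
  qed (auto simp: children_def T1_carrier)
  have "bij_betw (\<lambda>x. c \<otimes> x) {x \<in> carrier H. x [^] k = \<one>} (children a)"
  proof (rule bij_betw_imageI)
    show "inj_on (\<lambda>x. c \<otimes> x) {x \<in> carrier H. x [^] k = \<one>}"
      using cH by (auto intro: inj_onI)
    show "(\<lambda>x. c \<otimes> x) ` {x \<in> carrier H. x [^] k = \<one>} = children a"
    proof
      show "(\<lambda>x. c \<otimes> x) ` {x \<in> carrier H. x [^] k = \<one>} \<subseteq> children a"
      proof (rule image_subsetI)
        fix x assume "x \<in> {x \<in> carrier H. x [^] k = \<one>}"
        then have "c \<otimes> x \<in> carrier H" "(c \<otimes> x) [^] k = a"
          using cH c T1_carrier[OF a] by (simp_all add: nat_pow_distrib)
        then show "c \<otimes> x \<in> children a"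
          by (simp add: preimages)
      qed
      show "children a \<subseteq> (\<lambda>x. c \<otimes> x) ` {x \<in> carrier H. x [^] k = \<one>}"
      proof
        fix y assume "y \<in> children a"
        then have y: "y \<in> carrier H" "y [^] k = a"
          by (simp_all add: preimages)
        then have "(inv c \<otimes> y) [^] k = \<one>"
          using cH c T1_carrier[OF a] by (simp add: nat_pow_distrib nat_pow_inv)
        moreover have "y = c \<otimes> (inv c \<otimes> y)"
          using y cH by (simp add: inv_solve_left flip: m_assoc)
        ultimately show "y \<in> (\<lambda>x. c \<otimes> x) ` {x \<in> carrier H. x [^] k = \<one>}"
          using y cH by blast
      qed
    qed
  qed
  then show ?thesis
    using card_roots_of_unity_cyclic[OF cyclic finite_carrier k_dvd_order]
    by (simp add: bij_betw_same_card)
qed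

lemma descendants_max_height:
  assumes a: "a \<in> T1" and ht: "ht a = max_height H k"
  shows "descendants a = {a}"
  using self_descendant[OF a] proper_descendant_height[OF a] height_le_max ht
  by (auto simp: descendants_iff[OF a] T1_carrier order.strict_iff_order)

end

theorem proposition5p10:
  fixes H :: "('a, 'm) monoid_scheme" and n k :: nat
  assumes "group H" and "cyclic_group H" and "order H = n"
    and "n > 1" and "1 \<le> k" and "k \<le> n"
    and "prime k" and "gcd n k = k"
  shows
    "(\<forall>a\<in>tree_one_verts H k. height H k a = 1 \<longrightarrow>
        digraph_aut (tree_one H k) \<cong>
          wreath_product (digraph_aut (tree_from H k a)) (verts (tree_from H k a))
            (sym_group (k - 1)) {1..k - 1})
     \<and> (\<forall>h. 1 \<le> h \<and> h < max_height H k \<longrightarrow>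
          (\<forall>a\<in>tree_one_verts H k. \<forall>b\<in>tree_one_verts H k.
             height H k a = h \<and> height H k b = h + 1 \<longrightarrow>
             digraph_aut (tree_from H k a) \<cong>
               wreath_product (digraph_aut (tree_from H k b)) (verts (tree_from H k b))
                 (sym_group k) {1..k}))
     \<and> (\<forall>a\<in>tree_one_verts H k. height H k a = max_height H k \<longrightarrow>
          carrier (digraph_aut (tree_from H k a)) = {\<one>\<^bsub>digraph_aut (tree_from H k a)\<^esub>})"
proof -
  interpret group H by fact
  interpret cyclic_prime_power H k
  proof unfold_locales
    show "finite (carrier H)"
      using assms(3,4) by (auto simp: order_def intro: card_ge_0_finite)
    show "k dvd order H"
      using assms(3,8) by (metis gcd_dvd1)
  qed fact+
  have tree_from: "tree_from H k a = tree_at a" if "a \<in> T1" "ht a \<ge> 1" for a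
    using that height_eq_0_iff[of a] by (auto simp: tree_at_def)
  show ?thesis
  proof (intro conjI allI ballI impI)
    fix a assume a: "a \<in> T1" "ht a = 1"
    then show "digraph_aut (tree_one H k) \<cong>
        wreath_product (digraph_aut (tree_from H k a)) (verts (tree_from H k a))
          (sym_group (k - 1)) {1..k - 1}"
      using tree_at_iso_wreath_product[OF one_in_T1 a(1)] height_eq_0_iff[OF one_in_T1]
      by (simp only: card_children_one tree_from) (simp add: tree_at_def)
  next
    fix h a b
    assume h: "1 \<le> h \<and> h < max_height H k" and a: "a \<in> T1" and b: "b \<in> T1"
      and ht: "ht a = h \<and> ht b = h + 1"
    have "card (children a) = k"
      using a h ht by (intro card_children) simp_all
    then show "digraph_aut (tree_from H k a) \<cong>
        wreath_product (digraph_aut (tree_from H k b)) (verts (tree_from H k b))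
          (sym_group k) {1..k}"
      using tree_at_iso_wreath_product[OF a b] a b h ht by (simp add: tree_from)
  next
    fix a assume a: "a \<in> T1" "ht a = max_height H k"
    have verts: "verts (tree_from H k a) = {a}"
      using descendants_max_height[OF a] by (simp add: tree_from_def descendants_def)
    show "carrier (digraph_aut (tree_from H k a)) = {\<one>\<^bsub>digraph_aut (tree_from H k a)\<^esub>}"
    proof
      show "carrier (digraph_aut (tree_from H k a)) \<subseteq> {\<one>\<^bsub>digraph_aut (tree_from H k a)\<^esub>}"
        by (auto simp: digraph_aut_def verts perm_group_def)
      show "{\<one>\<^bsub>digraph_aut (tree_from H k a)\<^esub>} \<subseteq> carrier (digraph_aut (tree_from H k a))"
        by (simp add: digraph_aut_iff nomulti_digraph_trees)
          (simp add: digraph_aut_def perm_group_def permutes_id)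
    qed
  qed
qed

end
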